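(* Let $A^1\subseteq\mathbb{R}^q$ and $A^2\subseteq\mathbb{R}^q$ be polyhedra with P-representations $(M^1,B^1,a^1,b^1,l^1,u^1)$ and $(M^2,B^2,a^2,b^2,l^2,u^2)$, respectively. Then the intersection $A^1\cap A^2\subseteq\mathbb{R}^q$ is a polyhedron with P-representation $$\left(\begin{pmatrix} M^1 & 0\end{pmatrix},\ \begin{pmatrix} B^1 & 0\\ 0 & B^2\\ M^1 & -M^2\end{pmatrix},\ \begin{pmatrix} a^1\\ a^2\\ 0\end{pmatrix},\ \begin{pmatrix} b^1\\ b^2\\ 0\end{pmatrix},\ \begin{pmatrix} l^1\\ l^2\end{pmatrix},\ \begin{pmatrix} u^1\\ u^2\end{pmatrix}\right).$$
   Context: Given matrices $M\in\mathbb{R}^{q\times n}$, $B\in\mathbb{R}^{m\times n}$ and vectors $a\in(\mathbb{R}\cup\{-\infty\})^m$, $b\in(\mathbb{R}\cup\{+\infty\})^m$, $l\in(\mathbb{R}\cup\{-\infty\})^n$, $u\in(\mathbb{R}\cup\{+\infty\})^n$, the set $P=\{Mx \mid x\in\mathbb{R}^n,\ a\le Bx\le b,\ l\le x\le u\}\subseteq\mathbb{R}^q$ (inequalities componentwise) is called a (convex) polyhedron, and the tuple $(M,B,a,b,l,u)$ is called a P-representation of $P$. The two P-representations may have different numbers of variables and constraints: $M^i\in\mathbb{R}^{q\times n_i}$, $B^i\in\mathbb{R}^{m_i\times n_i}$ for $i=1,2$. The symbol $0$ in block matrices and vectors denotes zero blocks of appropriate size. *)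

theory Defs
  imports "Jordan_Normal_Form.Matrix" "HOL-Library.Extended_Real"
begin

definition append_cols :: "'a :: zero mat \<Rightarrow> 'a mat \<Rightarrow> 'a mat" (infixr \<open>@\<^sub>c\<close> 65) where
  "A @\<^sub>c B = four_block_mat A B (0\<^sub>m 0 (dim_col A)) (0\<^sub>m 0 (dim_col B))"

text \<open>The tuple \<open>(M, B, a, b, l, u)\<close>; the bound vectors may have infinite entries.\<close>
type_synonym p_tuple =
  "real mat \<times> real mat \<times> ereal vec \<times> ereal vec \<times> ereal vec \<times> ereal vec"

text \<open>\<open>q\<close> is the dimension of the ambient space, \<open>n\<close> the number of variables and \<open>m\<close> the number
  of constraints. Lower bounds take values in the reals extended by \<open>-\<infinity>\<close> only, upper bounds in
  the reals extended by \<open>+\<infinity>\<close> only.\<close>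
fun wf_p_tuple :: "nat \<Rightarrow> nat \<Rightarrow> nat \<Rightarrow> p_tuple \<Rightarrow> bool" where
  "wf_p_tuple q n m (M, B, a, b, l, u) \<longleftrightarrow>
     M \<in> carrier_mat q n \<and> B \<in> carrier_mat m n \<and>
     a \<in> carrier_vec m \<and> b \<in> carrier_vec m \<and> l \<in> carrier_vec n \<and> u \<in> carrier_vec n \<and>
     (\<forall>i<m. a $ i \<noteq> \<infinity> \<and> b $ i \<noteq> -\<infinity>) \<and>
     (\<forall>j<n. l $ j \<noteq> \<infinity> \<and> u $ j \<noteq> -\<infinity>)"

text \<open>The order on vectors of equal dimension is componentwise.\<close>
fun p_set :: "p_tuple \<Rightarrow> real vec set" where
  "p_set (M, B, a, b, l, u) =
     {M *\<^sub>v x | x. x \<in> carrier_vec (dim_col M) \<and>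
        a \<le> map_vec ereal (B *\<^sub>v x) \<and> map_vec ereal (B *\<^sub>v x) \<le> b \<and>
        l \<le> map_vec ereal x \<and> map_vec ereal x \<le> u}"

definition P_representation ::
    "nat \<Rightarrow> nat \<Rightarrow> nat \<Rightarrow> p_tuple \<Rightarrow> real vec set \<Rightarrow> bool" where
  "P_representation q n m R P \<longleftrightarrow> wf_p_tuple q n m R \<and> P = p_set R"

definition polyhedron :: "nat \<Rightarrow> real vec set \<Rightarrow> bool" where
  "polyhedron q P \<longleftrightarrow> (\<exists>n m R. P_representation q n m R P)"

end

theory Submission
  imports Defs
begin

text \<open>A point lies in both polyhedra iff it can be written as \<open>M\<^sub>1 x\<^sub>1\<close> and as \<open>M\<^sub>2 x\<^sub>2\<close> with \<open>x\<^sub>1\<close> feasible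
  for the first system and \<open>x\<^sub>2\<close> feasible for the second one. The combined representation carries
  both preimages along as the single variable \<open>(x\<^sub>1, x\<^sub>2)\<close>: the block-diagonal rows and the stacked
  bounds impose the two systems independently of each other, the rows \<open>(M\<^sub>1, -M\<^sub>2)\<close>, bounded by \<open>0\<close> from
  both sides, force \<open>M\<^sub>1 x\<^sub>1 = M\<^sub>2 x\<^sub>2\<close>, and \<open>(M\<^sub>1, 0)\<close> maps the pair to this common image. The step
  that carries this is \<open>p_feasible_intersection\<close>: feasibility of the pair for the combined system
  amounts to feasibility of both components together with \<open>M\<^sub>1 x\<^sub>1 = M\<^sub>2 x\<^sub>2\<close>.\<close>

lemma append_cols_carrier:
  assumes "A \<in> carrier_mat r c" and "B \<in> carrier_mat r d"
  shows "A @\<^sub>c B \<in> carrier_mat r (c + d)"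
  using assms unfolding append_cols_def by auto

lemma zero_mat_mult_vec:
  fixes x :: "'a :: semiring_0 vec"
  assumes "x \<in> carrier_vec c"
  shows "0\<^sub>m r c *\<^sub>v x = 0\<^sub>v r"
  using assms by (intro eq_vecI) auto

lemma append_cols_mult_append_vec:
  fixes A B :: "'a :: comm_ring_1 mat"
  assumes A: "A \<in> carrier_mat r c" and B: "B \<in> carrier_mat r d"
    and x: "x \<in> carrier_vec c" and y: "y \<in> carrier_vec d"
  shows "(A @\<^sub>c B) *\<^sub>v (x @\<^sub>v y) = A *\<^sub>v x + B *\<^sub>v y"
proof -
  have "(A @\<^sub>c B) *\<^sub>v (x @\<^sub>v y)
      = (A *\<^sub>v x + B *\<^sub>v y) @\<^sub>v (0\<^sub>m 0 c *\<^sub>v x + 0\<^sub>m 0 d *\<^sub>v y)"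
    using A B x y unfolding append_cols_def
    by (subst four_block_mat_mult_vec[where ?nr1.0 = r and ?nr2.0 = 0]) auto
  then show ?thesis
    using A B by (intro eq_vecI) auto
qed

lemma block_diag_mult_append_vec:
  fixes A D :: "'a :: comm_ring_1 mat"
  assumes A: "A \<in> carrier_mat r c" and D: "D \<in> carrier_mat s d"
    and x: "x \<in> carrier_vec c" and y: "y \<in> carrier_vec d"
  shows "four_block_mat A (0\<^sub>m r d) (0\<^sub>m s c) D *\<^sub>v (x @\<^sub>v y) = A *\<^sub>v x @\<^sub>v D *\<^sub>v y"
  using assms by (subst four_block_mat_mult_vec[OF A _ _ D x y]) (auto simp: zero_mat_mult_vec)

lemma map_vec_append: "map_vec f (v @\<^sub>v w) = map_vec f v @\<^sub>v map_vec f w"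
  by (intro eq_vecI) auto

lemma append_vec_assoc: "(u @\<^sub>v v) @\<^sub>v w = u @\<^sub>v v @\<^sub>v w"
  by (intro eq_vecI) auto

lemma append_vec_avoids:
  assumes "v \<in> carrier_vec n" and "w \<in> carrier_vec m"
    and "\<forall>i<n. v $ i \<noteq> c" and "\<forall>i<m. w $ i \<noteq> c"
  shows "\<forall>i<n + m. (v @\<^sub>v w) $ i \<noteq> c"
  using assms by auto

lemma minus_vec_eq_zero_iff:
  fixes v w :: "'a :: group_add vec"
  assumes "v \<in> carrier_vec q" and "w \<in> carrier_vec q"
  shows "v - w = 0\<^sub>v q \<longleftrightarrow> v = w"
  using assms by (auto simp: vec_eq_iff)

text \<open>By antisymmetry, a constraint row with both bounds \<open>0\<close> is an equation.\<close>

lemma map_ereal_between_zero_iff: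
  "0\<^sub>v q \<le> map_vec ereal v \<and> map_vec ereal v \<le> 0\<^sub>v q \<longleftrightarrow> v = 0\<^sub>v q"
proof -
  have "map_vec ereal v = 0\<^sub>v q \<longleftrightarrow> v = 0\<^sub>v q"
    by (auto simp: vec_eq_iff)
  then show ?thesis
    by (metis order.antisym order.refl)
qed

lemma wf_p_tupleD:
  assumes "wf_p_tuple q n m (M, B, a, b, l, u)"
  shows "M \<in> carrier_mat q n" "B \<in> carrier_mat m n" "a \<in> carrier_vec m" "b \<in> carrier_vec m"
    "l \<in> carrier_vec n" "u \<in> carrier_vec n"
  using assms by auto

definition p_feasible ::
    "real mat \<Rightarrow> ereal vec \<Rightarrow> ereal vec \<Rightarrow> ereal vec \<Rightarrow> ereal vec \<Rightarrow> real vec \<Rightarrow> bool" where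
  "p_feasible B a b l u x \<longleftrightarrow>
     a \<le> map_vec ereal (B *\<^sub>v x) \<and> map_vec ereal (B *\<^sub>v x) \<le> b \<and>
     l \<le> map_vec ereal x \<and> map_vec ereal x \<le> u"

lemma p_set_eq_image_feasible:
  assumes "M \<in> carrier_mat q n"
  shows "p_set (M, B, a, b, l, u) = (*\<^sub>v) M ` {x \<in> carrier_vec n. p_feasible B a b l u x}"
  using assms by (auto simp: p_feasible_def)

text \<open>Since the order on vectors is componentwise, each of the four inequalities of the combined
  system splits along its blocks. The last block contributes the coupling of the two variables.\<close>

lemma p_feasible_intersection:
  assumes wf\<^sub>1: "wf_p_tuple q n\<^sub>1 m\<^sub>1 (M\<^sub>1, B\<^sub>1, a\<^sub>1, b\<^sub>1, l\<^sub>1, u\<^sub>1)"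
    and wf\<^sub>2: "wf_p_tuple q n\<^sub>2 m\<^sub>2 (M\<^sub>2, B\<^sub>2, a\<^sub>2, b\<^sub>2, l\<^sub>2, u\<^sub>2)"
    and x\<^sub>1: "x\<^sub>1 \<in> carrier_vec n\<^sub>1" and x\<^sub>2: "x\<^sub>2 \<in> carrier_vec n\<^sub>2"
  shows "p_feasible
      (four_block_mat B\<^sub>1 (0\<^sub>m m\<^sub>1 n\<^sub>2) (0\<^sub>m m\<^sub>2 n\<^sub>1) B\<^sub>2 @\<^sub>r (M\<^sub>1 @\<^sub>c - M\<^sub>2))
      (a\<^sub>1 @\<^sub>v a\<^sub>2 @\<^sub>v 0\<^sub>v q) (b\<^sub>1 @\<^sub>v b\<^sub>2 @\<^sub>v 0\<^sub>v q) (l\<^sub>1 @\<^sub>v l\<^sub>2) (u\<^sub>1 @\<^sub>v u\<^sub>2) (x\<^sub>1 @\<^sub>v x\<^sub>2)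
    \<longleftrightarrow> p_feasible B\<^sub>1 a\<^sub>1 b\<^sub>1 l\<^sub>1 u\<^sub>1 x\<^sub>1 \<and> p_feasible B\<^sub>2 a\<^sub>2 b\<^sub>2 l\<^sub>2 u\<^sub>2 x\<^sub>2 \<and> M\<^sub>1 *\<^sub>v x\<^sub>1 = M\<^sub>2 *\<^sub>v x\<^sub>2"
    (is "p_feasible ?B ?a ?b ?l ?u ?x \<longleftrightarrow> _")
proof -
  note c\<^sub>1 = wf_p_tupleD[OF wf\<^sub>1] and c\<^sub>2 = wf_p_tupleD[OF wf\<^sub>2]
  have y\<^sub>1: "map_vec ereal (B\<^sub>1 *\<^sub>v x\<^sub>1) \<in> carrier_vec m\<^sub>1"
    and y\<^sub>2: "map_vec ereal (B\<^sub>2 *\<^sub>v x\<^sub>2) \<in> carrier_vec m\<^sub>2"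
    and e\<^sub>1: "map_vec ereal x\<^sub>1 \<in> carrier_vec n\<^sub>1"
    using c\<^sub>1 c\<^sub>2 x\<^sub>1 x\<^sub>2 by auto
  have "(M\<^sub>1 @\<^sub>c - M\<^sub>2) *\<^sub>v ?x = M\<^sub>1 *\<^sub>v x\<^sub>1 + - M\<^sub>2 *\<^sub>v x\<^sub>2"
    using c\<^sub>1 c\<^sub>2 x\<^sub>1 x\<^sub>2 by (intro append_cols_mult_append_vec) auto
  also have "\<dots> = M\<^sub>1 *\<^sub>v x\<^sub>1 - M\<^sub>2 *\<^sub>v x\<^sub>2"
    using c\<^sub>1 c\<^sub>2 x\<^sub>2 by (intro eq_vecI) auto
  finally have coupling: "(M\<^sub>1 @\<^sub>c - M\<^sub>2) *\<^sub>v ?x = M\<^sub>1 *\<^sub>v x\<^sub>1 - M\<^sub>2 *\<^sub>v x\<^sub>2" .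
  have "?B *\<^sub>v ?x = four_block_mat B\<^sub>1 (0\<^sub>m m\<^sub>1 n\<^sub>2) (0\<^sub>m m\<^sub>2 n\<^sub>1) B\<^sub>2 *\<^sub>v ?x @\<^sub>v (M\<^sub>1 @\<^sub>c - M\<^sub>2) *\<^sub>v ?x"
    using c\<^sub>1 c\<^sub>2 x\<^sub>1 x\<^sub>2
    by (intro mat_mult_append[where nc = "n\<^sub>1 + n\<^sub>2" and ?nr1.0 = "m\<^sub>1 + m\<^sub>2" and ?nr2.0 = q]
        four_block_carrier_mat append_cols_carrier append_carrier_vec) auto
  also have "\<dots> = (B\<^sub>1 *\<^sub>v x\<^sub>1 @\<^sub>v B\<^sub>2 *\<^sub>v x\<^sub>2) @\<^sub>v (M\<^sub>1 *\<^sub>v x\<^sub>1 - M\<^sub>2 *\<^sub>v x\<^sub>2)"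
    unfolding coupling using c\<^sub>1 c\<^sub>2 x\<^sub>1 x\<^sub>2 by (subst block_diag_mult_append_vec) auto
  also have "\<dots> = B\<^sub>1 *\<^sub>v x\<^sub>1 @\<^sub>v B\<^sub>2 *\<^sub>v x\<^sub>2 @\<^sub>v (M\<^sub>1 *\<^sub>v x\<^sub>1 - M\<^sub>2 *\<^sub>v x\<^sub>2)"
    by (rule append_vec_assoc)
  finally have Bx: "map_vec ereal (?B *\<^sub>v ?x) = map_vec ereal (B\<^sub>1 *\<^sub>v x\<^sub>1)
      @\<^sub>v map_vec ereal (B\<^sub>2 *\<^sub>v x\<^sub>2) @\<^sub>v map_vec ereal (M\<^sub>1 *\<^sub>v x\<^sub>1 - M\<^sub>2 *\<^sub>v x\<^sub>2)"
    by (simp only: map_vec_append)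
  have equation: "M\<^sub>1 *\<^sub>v x\<^sub>1 = M\<^sub>2 *\<^sub>v x\<^sub>2 \<longleftrightarrow>
      0\<^sub>v q \<le> map_vec ereal (M\<^sub>1 *\<^sub>v x\<^sub>1 - M\<^sub>2 *\<^sub>v x\<^sub>2) \<and>
      map_vec ereal (M\<^sub>1 *\<^sub>v x\<^sub>1 - M\<^sub>2 *\<^sub>v x\<^sub>2) \<le> 0\<^sub>v q"
    unfolding map_ereal_between_zero_iff
    using c\<^sub>1 c\<^sub>2 x\<^sub>1 x\<^sub>2 by (subst minus_vec_eq_zero_iff) auto
  show ?thesis
    unfolding p_feasible_def Bx map_vec_append equation
      append_vec_le[OF c\<^sub>1(3) y\<^sub>1] append_vec_le[OF c\<^sub>2(3) y\<^sub>2]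
      append_vec_le[OF y\<^sub>1 c\<^sub>1(4)] append_vec_le[OF y\<^sub>2 c\<^sub>2(4)]
      append_vec_le[OF c\<^sub>1(5) e\<^sub>1] append_vec_le[OF e\<^sub>1 c\<^sub>1(6)]
    by (simp only: conj_ac)
qed

theorem proposition3:
  fixes q n\<^sub>1 m\<^sub>1 n\<^sub>2 m\<^sub>2 :: nat
    and A\<^sub>1 A\<^sub>2 :: "real vec set"
    and M\<^sub>1 B\<^sub>1 M\<^sub>2 B\<^sub>2 :: "real mat"
    and a\<^sub>1 b\<^sub>1 l\<^sub>1 u\<^sub>1 a\<^sub>2 b\<^sub>2 l\<^sub>2 u\<^sub>2 :: "ereal vec"
  assumes "P_representation q n\<^sub>1 m\<^sub>1 (M\<^sub>1, B\<^sub>1, a\<^sub>1, b\<^sub>1, l\<^sub>1, u\<^sub>1) A\<^sub>1"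
    and "P_representation q n\<^sub>2 m\<^sub>2 (M\<^sub>2, B\<^sub>2, a\<^sub>2, b\<^sub>2, l\<^sub>2, u\<^sub>2) A\<^sub>2"
  shows "polyhedron q (A\<^sub>1 \<inter> A\<^sub>2) \<and>
    P_representation q (n\<^sub>1 + n\<^sub>2) (m\<^sub>1 + m\<^sub>2 + q)
      (M\<^sub>1 @\<^sub>c 0\<^sub>m q n\<^sub>2,
       four_block_mat B\<^sub>1 (0\<^sub>m m\<^sub>1 n\<^sub>2)
                      (0\<^sub>m m\<^sub>2 n\<^sub>1) B\<^sub>2
         @\<^sub>r (M\<^sub>1 @\<^sub>c - M\<^sub>2),
       a\<^sub>1 @\<^sub>v a\<^sub>2 @\<^sub>v 0\<^sub>v q,
       b\<^sub>1 @\<^sub>v b\<^sub>2 @\<^sub>v 0\<^sub>v q,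
       l\<^sub>1 @\<^sub>v l\<^sub>2,
       u\<^sub>1 @\<^sub>v u\<^sub>2)
      (A\<^sub>1 \<inter> A\<^sub>2)"
  (is "_ \<and> P_representation _ _ _ (?M, ?B, ?a, ?b, ?l, ?u) _")
proof -
  have wf\<^sub>1: "wf_p_tuple q n\<^sub>1 m\<^sub>1 (M\<^sub>1, B\<^sub>1, a\<^sub>1, b\<^sub>1, l\<^sub>1, u\<^sub>1)"
    and A\<^sub>1: "A\<^sub>1 = p_set (M\<^sub>1, B\<^sub>1, a\<^sub>1, b\<^sub>1, l\<^sub>1, u\<^sub>1)"
    and wf\<^sub>2: "wf_p_tuple q n\<^sub>2 m\<^sub>2 (M\<^sub>2, B\<^sub>2, a\<^sub>2, b\<^sub>2, l\<^sub>2, u\<^sub>2)"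
    and A\<^sub>2: "A\<^sub>2 = p_set (M\<^sub>2, B\<^sub>2, a\<^sub>2, b\<^sub>2, l\<^sub>2, u\<^sub>2)"
    using assms unfolding P_representation_def by blast+
  note c\<^sub>1 = wf_p_tupleD[OF wf\<^sub>1] and c\<^sub>2 = wf_p_tupleD[OF wf\<^sub>2]
  have M: "?M \<in> carrier_mat q (n\<^sub>1 + n\<^sub>2)"
    using c\<^sub>1 by (intro append_cols_carrier) auto
  have Mx: "?M *\<^sub>v (x\<^sub>1 @\<^sub>v x\<^sub>2) = M\<^sub>1 *\<^sub>v x\<^sub>1"
    if "x\<^sub>1 \<in> carrier_vec n\<^sub>1" "x\<^sub>2 \<in> carrier_vec n\<^sub>2" for x\<^sub>1 x\<^sub>2
    using c\<^sub>1 that by (subst append_cols_mult_append_vec) (auto simp: zero_mat_mult_vec)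
  have B: "?B \<in> carrier_mat (m\<^sub>1 + m\<^sub>2 + q) (n\<^sub>1 + n\<^sub>2)"
    using c\<^sub>1 c\<^sub>2 by (intro carrier_append_rows four_block_carrier_mat append_cols_carrier) auto
  have "wf_p_tuple q (n\<^sub>1 + n\<^sub>2) (m\<^sub>1 + m\<^sub>2 + q) (?M, ?B, ?a, ?b, ?l, ?u)"
  proof -
    have bounds: "\<forall>i<m\<^sub>1. a\<^sub>1 $ i \<noteq> \<infinity>" "\<forall>i<m\<^sub>1. b\<^sub>1 $ i \<noteq> -\<infinity>"
      "\<forall>j<n\<^sub>1. l\<^sub>1 $ j \<noteq> \<infinity>" "\<forall>j<n\<^sub>1. u\<^sub>1 $ j \<noteq> -\<infinity>"
      "\<forall>i<m\<^sub>2. a\<^sub>2 $ i \<noteq> \<infinity>" "\<forall>i<m\<^sub>2. b\<^sub>2 $ i \<noteq> -\<infinity>"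
      "\<forall>j<n\<^sub>2. l\<^sub>2 $ j \<noteq> \<infinity>" "\<forall>j<n\<^sub>2. u\<^sub>2 $ j \<noteq> -\<infinity>"
      using wf\<^sub>1 wf\<^sub>2 unfolding wf_p_tuple.simps by blast+
    have zero: "\<forall>i<q. 0\<^sub>v q $ i \<noteq> (\<infinity> :: ereal)" "\<forall>i<q. 0\<^sub>v q $ i \<noteq> (-\<infinity> :: ereal)"
      by auto
    \<comment> \<open>The dimension is bracketed to the right, like the stacked bound vectors.\<close>
    have "\<forall>i<m\<^sub>1 + (m\<^sub>2 + q). ?a $ i \<noteq> \<infinity>" "\<forall>i<m\<^sub>1 + (m\<^sub>2 + q). ?b $ i \<noteq> -\<infinity>"
      "\<forall>j<n\<^sub>1 + n\<^sub>2. ?l $ j \<noteq> \<infinity>" "\<forall>j<n\<^sub>1 + n\<^sub>2. ?u $ j \<noteq> -\<infinity>"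
      by (intro append_vec_avoids append_carrier_vec zero_carrier_vec c\<^sub>1 c\<^sub>2 bounds zero)+
    moreover have "?a \<in> carrier_vec (m\<^sub>1 + (m\<^sub>2 + q))" "?b \<in> carrier_vec (m\<^sub>1 + (m\<^sub>2 + q))"
      "?l \<in> carrier_vec (n\<^sub>1 + n\<^sub>2)" "?u \<in> carrier_vec (n\<^sub>1 + n\<^sub>2)"
      by (intro append_carrier_vec zero_carrier_vec c\<^sub>1 c\<^sub>2)+
    ultimately show ?thesis
      using M B unfolding wf_p_tuple.simps add.assoc by blast
  qed
  moreover have "A\<^sub>1 \<inter> A\<^sub>2 = p_set (?M, ?B, ?a, ?b, ?l, ?u)"
  proof (intro equalityI subsetI)
    fix y assume "y \<in> A\<^sub>1 \<inter> A\<^sub>2"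
    then obtain x\<^sub>1 x\<^sub>2 where x: "x\<^sub>1 \<in> carrier_vec n\<^sub>1" "x\<^sub>2 \<in> carrier_vec n\<^sub>2"
      and feas: "p_feasible B\<^sub>1 a\<^sub>1 b\<^sub>1 l\<^sub>1 u\<^sub>1 x\<^sub>1" "p_feasible B\<^sub>2 a\<^sub>2 b\<^sub>2 l\<^sub>2 u\<^sub>2 x\<^sub>2"
      and y: "y = M\<^sub>1 *\<^sub>v x\<^sub>1" "y = M\<^sub>2 *\<^sub>v x\<^sub>2"
      unfolding A\<^sub>1 A\<^sub>2 p_set_eq_image_feasible[OF c\<^sub>1(1)] p_set_eq_image_feasible[OF c\<^sub>2(1)] by blast
    have "p_feasible ?B ?a ?b ?l ?u (x\<^sub>1 @\<^sub>v x\<^sub>2)"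
      using feas y p_feasible_intersection[OF wf\<^sub>1 wf\<^sub>2 x] by simp
    moreover have "y = ?M *\<^sub>v (x\<^sub>1 @\<^sub>v x\<^sub>2)"
      using Mx[OF x] y by simp
    ultimately show "y \<in> p_set (?M, ?B, ?a, ?b, ?l, ?u)"
      unfolding p_set_eq_image_feasible[OF M] using x append_carrier_vec by blast
  next
    fix y assume "y \<in> p_set (?M, ?B, ?a, ?b, ?l, ?u)"
    then obtain x where x: "x \<in> carrier_vec (n\<^sub>1 + n\<^sub>2)"
      and feas: "p_feasible ?B ?a ?b ?l ?u x" and y: "y = ?M *\<^sub>v x"
      unfolding p_set_eq_image_feasible[OF M] by blast
    define x\<^sub>1 x\<^sub>2 where "x\<^sub>1 = vec_first x n\<^sub>1" and "x\<^sub>2 = vec_last x n\<^sub>2"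
    have x\<^sub>1\<^sub>2: "x\<^sub>1 \<in> carrier_vec n\<^sub>1" "x\<^sub>2 \<in> carrier_vec n\<^sub>2" and split: "x = x\<^sub>1 @\<^sub>v x\<^sub>2"
      using x by (auto simp: x\<^sub>1_def x\<^sub>2_def)
    from feas have "p_feasible B\<^sub>1 a\<^sub>1 b\<^sub>1 l\<^sub>1 u\<^sub>1 x\<^sub>1" "p_feasible B\<^sub>2 a\<^sub>2 b\<^sub>2 l\<^sub>2 u\<^sub>2 x\<^sub>2"
      "M\<^sub>1 *\<^sub>v x\<^sub>1 = M\<^sub>2 *\<^sub>v x\<^sub>2"
      unfolding split p_feasible_intersection[OF wf\<^sub>1 wf\<^sub>2 x\<^sub>1\<^sub>2] by blast+
    moreover have "y = M\<^sub>1 *\<^sub>v x\<^sub>1"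
      using Mx[OF x\<^sub>1\<^sub>2] y split by simp
    ultimately show "y \<in> A\<^sub>1 \<inter> A\<^sub>2"
      unfolding A\<^sub>1 A\<^sub>2 p_set_eq_image_feasible[OF c\<^sub>1(1)] p_set_eq_image_feasible[OF c\<^sub>2(1)]
      using x\<^sub>1\<^sub>2 by blast
  qed
  ultimately show ?thesis
    unfolding polyhedron_def P_representation_def by blast
qed

end
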